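(* Let $F=\frac1n\sum_{i=1}^nF_i$ with $F_i:\mathbb{R}^d\to\mathbb{R}^d$ being $L_i$-Lipschitz operators for $i=1,\dots,n$, let $x_*$ satisfy $F(x_* )=0$, and let $v$ be a sampling vector with associated estimator $F_v$. Then the Expected Residual condition holds. If, in addition, the vector $v\in\mathbb{R}^n$ is a $\tau$-minibatch sampling, then $$\delta=\frac{2}{n\tau}\,\frac{n-\tau}{n-1}\sum_{i=1}^nL_i^2,\qquad\text{and}\qquad \sigma_*^2=\frac1{n\tau}\,\frac{n-\tau}{n-1}\sum_{i=1}^n\|F_i(x_* )\|^2,$$ where $\delta$ is the parameter of the Expected Residual condition and $\sigma_*^2:=\mathbb{E}\|F_v(x_* )\|^2$.
   Context: A sampling vector is a random vector $v\in\mathbb{R}^n_+$ drawn from any user-defined distribution $\mathcal D$ such that $\mathbb{E}_{\mathcal D}[v_i]=1$ for $i=1,\dots,n$; the associated unbiased estimator of $F$ is $F_v(x):=\frac1n\sum_{i=1}^nv_iF_i(x)$. Expected Residual (ER) condition: there is a parameter $\delta>0$ such that the unbiased estimator $g(x)=F_v(x)$ of the operator $F$ satisfies, for $x\in\mathbb{R}^d$, $\mathbb{E}\left[\|(g(x)-g(x_* ))-(F(x)-F(x_* ))\|^2\right]\le\frac\delta2\|x-x_*\|^2$. $\tau$-minibatch sampling, $\tau\in\{1,\dots,n\}$: for every subset $S\subseteq\{1,\dots,n\}$ with $|S|=\tau$, $\mathbb{P}\left[v=\frac n\tau\sum_{i\in S}e_i\right]=1/\binom n\tau=\frac{\tau!(n-\tau)!}{n!}$,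 where $e_i$ are the standard basis vectors of $\mathbb{R}^n$.
   Formalization: For a general sampling vector, finite second moments E[v_i^2] are assumed (ER can fail without them); where the minibatch formula gives δ=0 (τ=n or all L_i=0) the ER inequality is stated with δ=0, and ER with some δ>0; for n=1 the factor (n-τ)/(n-1) is read as 0. *)

theory Defs
  imports "HOL-Probability.Probability"
begin

text \<open>
  The index set \<open>{1..n}\<close> is a finite type \<open>'n\<close> with \<open>n = CARD('n)\<close>. A sampling vector is represented
  by its law \<open>D\<close>, a probability measure on \<open>real ^ 'n\<close>.
\<close>

definition mean_operator :: "('n::finite \<Rightarrow> real ^ 'd \<Rightarrow> real ^ 'd) \<Rightarrow> real ^ 'd \<Rightarrow> real ^ 'd" where
  "mean_operator Fs x = (1 / real CARD('n)) *\<^sub>R (\<Sum>i\<in>UNIV. Fs i x)"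

definition estimator ::
  "('n::finite \<Rightarrow> real ^ 'd \<Rightarrow> real ^ 'd) \<Rightarrow> real ^ 'n \<Rightarrow> real ^ 'd \<Rightarrow> real ^ 'd" where
  "estimator Fs v x = (1 / real CARD('n)) *\<^sub>R (\<Sum>i\<in>UNIV. (v $ i) *\<^sub>R Fs i x)"

definition sampling_vector :: "(real ^ 'n::finite) measure \<Rightarrow> bool" where
  "sampling_vector D \<longleftrightarrow>
     prob_space D \<and> sets D = sets borel \<and>
     (AE v in D. \<forall>i. 0 \<le> v $ i) \<and>
     (\<forall>i. integrable D (\<lambda>v. v $ i) \<and> (LINT v|D. v $ i) = 1)"

definition minibatch_sampling :: "(real ^ 'n::finite) measure \<Rightarrow> nat \<Rightarrow> bool" where
  "minibatch_sampling D \<tau> \<longleftrightarrow>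
     \<tau> \<in> {1..CARD('n)} \<and>
     (\<forall>S :: 'n set. card S = \<tau> \<longrightarrow>
        measure D {(real CARD('n) / real \<tau>) *\<^sub>R (\<Sum>i\<in>S. axis i 1)} = 1 / real (CARD('n) choose \<tau>))"

definition residual_sq ::
  "('n::finite \<Rightarrow> real ^ 'd \<Rightarrow> real ^ 'd) \<Rightarrow> real ^ 'd \<Rightarrow> real ^ 'd \<Rightarrow> real ^ 'n \<Rightarrow> real" where
  "residual_sq Fs xs x v =
     (norm ((estimator Fs v x - estimator Fs v xs) - (mean_operator Fs x - mean_operator Fs xs)))\<^sup>2"

text \<open>
  Integrability is required explicitly because the Bochner integral of a non-integrable function
  is 0, which would make the inequality hold vacuously when the expectation is infinite.
\<close>

definition residual_bound ::
  "(real ^ 'n::finite) measure \<Rightarrow> ('n \<Rightarrow> real ^ 'd \<Rightarrow> real ^ 'd) \<Rightarrow> real ^ 'd \<Rightarrow> real \<Rightarrow> bool" where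
  "residual_bound D Fs xs \<delta> \<longleftrightarrow>
     (\<forall>x. integrable D (residual_sq Fs xs x) \<and>
          (LINT v|D. residual_sq Fs xs x v) \<le> \<delta> / 2 * (norm (x - xs))\<^sup>2)"

definition expected_residual ::
  "(real ^ 'n::finite) measure \<Rightarrow> ('n \<Rightarrow> real ^ 'd \<Rightarrow> real ^ 'd) \<Rightarrow> real ^ 'd \<Rightarrow> real \<Rightarrow> bool" where
  "expected_residual D Fs xs \<delta> \<longleftrightarrow> 0 < \<delta> \<and> residual_bound D Fs xs \<delta>"

definition sigma_star_sq ::
  "(real ^ 'n::finite) measure \<Rightarrow> ('n \<Rightarrow> real ^ 'd \<Rightarrow> real ^ 'd) \<Rightarrow> real ^ 'd \<Rightarrow> real" where
  "sigma_star_sq D Fs xs = (LINT v|D. (norm (estimator Fs v xs))\<^sup>2)"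

text \<open>
  The parameter for minibatch sampling. It is 0 when \<open>\<tau> = n\<close> or all \<open>L i\<close> vanish; for \<open>n = 1\<close>
  (hence \<open>\<tau> = 1\<close>) the quotient \<open>0 / 0\<close> evaluates to 0, which is the correct value there since
  then the estimator is almost surely equal to the operator.
\<close>

definition minibatch_delta :: "('n::finite \<Rightarrow> real) \<Rightarrow> nat \<Rightarrow> real" where
  "minibatch_delta L \<tau> =
     2 / (real CARD('n) * real \<tau>) * ((real CARD('n) - real \<tau>) / (real CARD('n) - 1)) *
     (\<Sum>i\<in>UNIV. (L i)\<^sup>2)"

end

theory Submission
  imports Defs
begin

text \<open>
  The centred estimator error at \<open>x\<close> is the mean of the vectors \<open>(v $ i - 1) *\<^sub>R w i\<close> with
  \<open>w i = Fs i x - Fs i xs\<close>, and the Lipschitz property bounds the norm of \<open>w i\<close> by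
  \<open>L i * norm (x - xs)\<close>. For a sampling vector with finite second moments, the Cauchy-Schwarz
  inequality therefore bounds the expected residual by a multiple of the squared distance to \<open>xs\<close>,
  the factor being a weighted sum of the variances of the \<open>v $ i\<close>
  (\<open>expected_residual_of_square_integrable\<close>).

  Minibatch sampling is sampling without replacement. Its law is carried by finitely many points,
  one for each set \<open>S\<close> of size \<open>\<tau>\<close>, all of the same weight, so that every expectation is an average
  over these sets (\<open>minibatch_has_bochner_integral\<close>). At the point of \<open>S\<close> the estimator is the plain
  mean of the operators in \<open>S\<close>. Both claims are thus about the average over \<open>S\<close> of the squared norm
  of a sample mean of vectors \<open>a i\<close> with sum zero: for \<open>\<sigma>\<^sub>*\<^sup>2\<close> these are the values \<open>Fs i xs\<close>, whose
  sum vanishes because \<open>xs\<close> is a root of the mean operator; for the residual they are the \<open>w i\<close> minus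
  their mean. The classical variance formula for sampling without replacement
  (\<open>subset_average_norm_sq_centred\<close>) evaluates this average. It gives the value of \<open>\<sigma>\<^sub>*\<^sup>2\<close> at once;
  for the residual it remains to note that subtracting the mean does not increase the sum of squared
  norms, and to insert the Lipschitz bounds.
\<close>

section \<open>Sums over subsets of fixed size\<close>

text \<open>Such a set is determined by its remaining \<open>k - 1\<close> elements, chosen from \<open>A - {i, j}\<close>.\<close>

lemma card_subsets_separating:
  assumes "finite A" "i \<in> A" "j \<in> A" "i \<noteq> j" "1 \<le> k"
  shows "card {S. S \<subseteq> A \<and> card S = k \<and> i \<in> S \<and> j \<notin> S} = (card A - 2) choose (k - 1)"
proof -
  let ?B = "{B. B \<subseteq> A - {i, j} \<and> card B = k - 1}"
  have fin: "finite S" if "S \<subseteq> A" for S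
    using that assms(1) finite_subset by blast
  have "bij_betw (insert i) ?B {S. S \<subseteq> A \<and> card S = k \<and> i \<in> S \<and> j \<notin> S}"
  proof (rule bij_betwI[where g = "\<lambda>S. S - {i}"])
    show "insert i \<in> ?B \<rightarrow> {S. S \<subseteq> A \<and> card S = k \<and> i \<in> S \<and> j \<notin> S}"
    proof
      fix B assume B: "B \<in> ?B"
      then have "finite B" "i \<notin> B" using fin by auto
      with B assms show "insert i B \<in> {S. S \<subseteq> A \<and> card S = k \<and> i \<in> S \<and> j \<notin> S}"
        by auto
    qed
    show "(\<lambda>S. S - {i}) \<in> {S. S \<subseteq> A \<and> card S = k \<and> i \<in> S \<and> j \<notin> S} \<rightarrow> ?B"
    proof
      fix S assume S: "S \<in> {S. S \<subseteq> A \<and> card S = k \<and> i \<in> S \<and> j \<notin> S}"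
      then have "card (S - {i}) = k - 1" by (simp add: card_Diff_singleton)
      with S show "S - {i} \<in> ?B" by blast
    qed
    show "insert i B - {i} = B" if "B \<in> ?B" for B using that by blast
    show "insert i (S - {i}) = S" if "S \<in> {S. S \<subseteq> A \<and> card S = k \<and> i \<in> S \<and> j \<notin> S}" for S
      using that by blast
  qed
  then have "card {S. S \<subseteq> A \<and> card S = k \<and> i \<in> S \<and> j \<notin> S} = card ?B"
    by (rule bij_betw_same_card[symmetric])
  also have "\<dots> = card (A - {i, j}) choose (k - 1)"
    using assms(1) by (simp add: n_subsets)
  also have "card (A - {i, j}) = card A - 2"
    using assms by (simp add: card_Diff_subset)
  finally show ?thesis .
qed

text \<open>
  As the vectors sum to zero, the sum over \<open>S\<close> is minus the sum over the complement of \<open>S\<close>, so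
  its squared norm only involves the products \<open>a i \<bullet> a j\<close> with \<open>i\<close> and \<open>j\<close> on different sides
  of \<open>S\<close>. Every pair \<open>i \<noteq> j\<close> is separated by the same number of sets, and the sum of
  \<open>a i \<bullet> a j\<close> over all \<open>j \<noteq> i\<close> is \<open>- a i \<bullet> a i\<close>.
\<close>

lemma sum_subsets_norm_sq_centred:
  fixes a :: "'i \<Rightarrow> 'a::real_inner"
  assumes A: "finite A" and k: "1 \<le> k" and zero: "(\<Sum>i\<in>A. a i) = 0"
  shows "(\<Sum>S | S \<subseteq> A \<and> card S = k. (norm (\<Sum>i\<in>S. a i))\<^sup>2) =
    real ((card A - 2) choose (k - 1)) * (\<Sum>i\<in>A. (norm (a i))\<^sup>2)"
proof -
  let ?T = "{S. S \<subseteq> A \<and> card S = k}"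
  let ?M = "real ((card A - 2) choose (k - 1))"
  have finT: "finite ?T" using A by simp
  have split: "(norm (\<Sum>i\<in>S. a i))\<^sup>2 =
      - (\<Sum>i\<in>A. \<Sum>j\<in>A. of_bool (i \<in> S \<and> j \<notin> S) * (a i \<bullet> a j))" if "S \<subseteq> A" for S
  proof -
    have "(\<Sum>i\<in>S. a i) = - (\<Sum>i\<in>A - S. a i)"
      using sum.subset_diff[OF that A, of a] zero by (simp add: eq_neg_iff_add_eq_0 add.commute)
    then have "(norm (\<Sum>i\<in>S. a i))\<^sup>2 = - ((\<Sum>i\<in>S. a i) \<bullet> (\<Sum>j\<in>A - S. a j))"
      by (metis inner_minus_right power2_norm_eq_inner)
    also have "\<dots> = - ((\<Sum>i\<in>A. of_bool (i \<in> S) *\<^sub>R a i) \<bullet> (\<Sum>j\<in>A. of_bool (j \<notin> S) *\<^sub>R a j))"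
    proof -
      have "(\<Sum>i\<in>S. a i) = (\<Sum>i\<in>A. of_bool (i \<in> S) *\<^sub>R a i)"
        using A that by (intro sum.mono_neutral_cong_left) auto
      moreover have "(\<Sum>j\<in>A - S. a j) = (\<Sum>j\<in>A. of_bool (j \<notin> S) *\<^sub>R a j)"
        using A by (intro sum.mono_neutral_cong_left) auto
      ultimately show ?thesis by simp
    qed
    also have "\<dots> = - (\<Sum>i\<in>A. \<Sum>j\<in>A. of_bool (i \<in> S \<and> j \<notin> S) * (a i \<bullet> a j))"
      unfolding inner_sum_left[of _ A]
      by (simp only: inner_sum_right inner_scaleR_left inner_scaleR_right of_bool_conj mult.assoc
          mult.left_commute)
    finally show ?thesis .
  qed
  have count: "(\<Sum>S\<in>?T. of_bool (i \<in> S \<and> j \<notin> S)) = (if i = j then 0 else ?M)"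
    if "i \<in> A" "j \<in> A" for i j
  proof -
    have "(\<Sum>S\<in>?T. of_bool (i \<in> S \<and> j \<notin> S)) =
        real (card {S. S \<subseteq> A \<and> card S = k \<and> i \<in> S \<and> j \<notin> S})"
      using finT by (simp add: of_bool_def sum.If_cases Collect_conj_eq Int_assoc)
    then show ?thesis
      using card_subsets_separating[OF A that _ k] by auto
  qed
  have rest: "(\<Sum>j\<in>A. (if i = j then 0 else ?M) * (a i \<bullet> a j)) = - ?M * (norm (a i))\<^sup>2"
    if "i \<in> A" for i
  proof -
    have "(\<Sum>j\<in>A. (if i = j then 0 else ?M) * (a i \<bullet> a j)) =
        (\<Sum>j\<in>A. ?M * (a i \<bullet> a j) - (if i = j then ?M * (a i \<bullet> a j) else 0))"
      by (intro sum.cong) auto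
    also have "\<dots> = ?M * (a i \<bullet> (\<Sum>j\<in>A. a j)) - ?M * (a i \<bullet> a i)"
      using A that by (simp add: sum_subtractf inner_sum_right sum_distrib_left)
    finally show ?thesis
      by (simp add: zero power2_norm_eq_inner)
  qed
  have "(\<Sum>S\<in>?T. (norm (\<Sum>i\<in>S. a i))\<^sup>2) =
      - (\<Sum>S\<in>?T. \<Sum>i\<in>A. \<Sum>j\<in>A. of_bool (i \<in> S \<and> j \<notin> S) * (a i \<bullet> a j))"
    using split by (simp add: sum_negf)
  also have "(\<Sum>S\<in>?T. \<Sum>i\<in>A. \<Sum>j\<in>A. of_bool (i \<in> S \<and> j \<notin> S) * (a i \<bullet> a j)) =
      (\<Sum>i\<in>A. \<Sum>S\<in>?T. \<Sum>j\<in>A. of_bool (i \<in> S \<and> j \<notin> S) * (a i \<bullet> a j))"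
    by (rule sum.swap)
  also have "\<dots> = (\<Sum>i\<in>A. \<Sum>j\<in>A. \<Sum>S\<in>?T. of_bool (i \<in> S \<and> j \<notin> S) * (a i \<bullet> a j))"
    by (intro sum.cong refl sum.swap)
  also have "\<dots> = (\<Sum>i\<in>A. \<Sum>j\<in>A. (if i = j then 0 else ?M) * (a i \<bullet> a j))"
    by (intro sum.cong refl) (simp only: sum_distrib_right[symmetric] count)
  also have "\<dots> = (\<Sum>i\<in>A. - ?M * (norm (a i))\<^sup>2)"
    by (intro sum.cong refl rest)
  finally show ?thesis
    by (simp add: sum_distrib_left sum_negf)
qed

text \<open>
  The probability that a random \<open>k\<close>-subset of an \<open>n\<close>-set contains one given point and misses
  another.
\<close>

lemma choose_separating_ratio:
  assumes "2 \<le> n" "1 \<le> k" "k \<le> n"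
  shows "real ((n - 2) choose (k - 1)) / real (n choose k) =
    real k * (real n - real k) / (real n * (real n - 1))"
proof -
  obtain m where n: "n = Suc (Suc m)"
    using assms(1) by (metis One_nat_def Suc_1 Suc_le_D Suc_le_mono)
  obtain l where l: "k = Suc l" using assms(2) by (cases k) auto
  have pos: "n choose k > 0" using assms(3) by simp
  have "real k * real (n choose k) = real n * real (Suc m choose l)"
    unfolding n l by (metis Suc_times_binomial_eq mult.commute of_nat_mult)
  moreover have "(real n - real k) * real (Suc m choose l) = (real n - 1) * real (m choose l)"
  proof -
    have "(Suc m - l) * (Suc m choose l) = Suc m * (m choose l)"
      using binomial_absorb_comp[of "Suc m" l] by simp
    moreover have "real n - real k = real (Suc m - l)" "real n - 1 = real (Suc m)"
      using assms(3) unfolding n l by (auto simp: of_nat_diff)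
    ultimately show ?thesis by (metis of_nat_mult)
  qed
  ultimately have "real k * (real n - real k) * real (n choose k) =
      real (m choose l) * (real n * (real n - 1))"
    by (metis (no_types, opaque_lifting) mult.assoc mult.commute)
  moreover have "real (n choose k) \<noteq> 0" "real n * (real n - 1) \<noteq> 0"
    using pos n by auto
  ultimately show ?thesis
    by (subst frac_eq_eq) (simp_all add: n l del: binomial_Suc_Suc)
qed

text \<open>
  The variance of the mean of a sample of size \<open>k\<close> drawn without replacement. For a population of
  one element the factor is \<open>0 / 0 = 0\<close>, and the only vector is zero because it is the whole sum.
\<close>

lemma subset_average_norm_sq_centred:
  fixes a :: "'n::finite \<Rightarrow> 'a::real_inner"
  assumes k: "1 \<le> k" "k \<le> CARD('n)" and zero: "(\<Sum>i\<in>UNIV. a i) = 0"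
  shows "(\<Sum>S | card S = k. (norm ((1 / real k) *\<^sub>R (\<Sum>i\<in>S. a i)))\<^sup>2) / real (CARD('n) choose k) =
    1 / (real CARD('n) * real k) * ((real CARD('n) - real k) / (real CARD('n) - 1)) *
    (\<Sum>i\<in>UNIV. (norm (a i))\<^sup>2)"
proof (cases "CARD('n) = 1")
  case True
  then obtain i0 :: 'n where U: "UNIV = {i0}" by (metis card_1_singletonE)
  have "a i = 0" for i
  proof -
    have "i = i0" using U by (metis UNIV_I singletonD)
    then show ?thesis using zero unfolding U by simp
  qed
  then show ?thesis by simp
next
  case False
  let ?n = "real CARD('n)" and ?s = "\<Sum>i\<in>UNIV. (norm (a i))\<^sup>2"
  have n: "2 \<le> CARD('n)"
    using False zero_less_card_finite[where 'a='n] by linarith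
  have "(\<Sum>S | card S = k. (norm ((1 / real k) *\<^sub>R (\<Sum>i\<in>S. a i)))\<^sup>2) =
      (1 / real k)\<^sup>2 * (\<Sum>S | card S = k. (norm (\<Sum>i\<in>S. a i))\<^sup>2)"
    by (simp add: power_mult_distrib sum_distrib_left power_divide)
  also have "\<dots> = (1 / real k)\<^sup>2 * (real ((CARD('n) - 2) choose (k - 1)) * ?s)"
    using sum_subsets_norm_sq_centred[OF finite k(1) zero] by simp
  finally have "(\<Sum>S | card S = k. (norm ((1 / real k) *\<^sub>R (\<Sum>i\<in>S. a i)))\<^sup>2) / real (CARD('n) choose k) =
      (1 / real k)\<^sup>2 * (real ((CARD('n) - 2) choose (k - 1)) / real (CARD('n) choose k)) * ?s"
    by simp
  also have "\<dots> = (1 / real k)\<^sup>2 * (real k * (?n - real k) / (?n * (?n - 1))) * ?s"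
    by (simp only: choose_separating_ratio[OF n k])
  also have "(1 / real k)\<^sup>2 * (real k * (?n - real k) / (?n * (?n - 1))) =
      1 / (?n * real k) * ((?n - real k) / (?n - 1))"
    using k n by (simp add: power2_eq_square)
  finally show ?thesis .
qed

text \<open>
  The difference of the two sides is \<open>CARD('n)\<close> times the squared norm of the mean.
\<close>

lemma sum_norm_sq_centred_le:
  fixes w :: "'n::finite \<Rightarrow> 'a::real_inner"
  defines "m \<equiv> (1 / real CARD('n)) *\<^sub>R (\<Sum>i\<in>UNIV. w i)"
  shows "(\<Sum>i\<in>UNIV. (norm (w i - m))\<^sup>2) \<le> (\<Sum>i\<in>UNIV. (norm (w i))\<^sup>2)"
proof -
  have s: "(\<Sum>i\<in>UNIV. w i) = real CARD('n) *\<^sub>R m" by (simp add: m_def)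
  have "(\<Sum>i\<in>UNIV. (norm (w i - m))\<^sup>2) =
      (\<Sum>i\<in>UNIV. (norm (w i))\<^sup>2 - 2 * (w i \<bullet> m) + (norm m)\<^sup>2)"
    by (intro sum.cong refl) (simp add: power2_norm_eq_inner algebra_simps inner_commute)
  also have "\<dots> = (\<Sum>i\<in>UNIV. (norm (w i))\<^sup>2) - 2 * ((\<Sum>i\<in>UNIV. w i) \<bullet> m) + real CARD('n) * (norm m)\<^sup>2"
    by (simp add: sum.distrib sum_subtractf inner_sum_left sum_distrib_left)
  also have "\<dots> = (\<Sum>i\<in>UNIV. (norm (w i))\<^sup>2) - real CARD('n) * (norm m)\<^sup>2"
    by (simp add: s power2_norm_eq_inner)
  finally show ?thesis by simp
qed

section \<open>The law of a minibatch sampling\<close>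

definition minibatch_vector :: "nat \<Rightarrow> 'n::finite set \<Rightarrow> real ^ 'n" where
  "minibatch_vector \<tau> S = (real CARD('n) / real \<tau>) *\<^sub>R (\<Sum>i\<in>S. axis i 1)"

lemma minibatch_vector_nth:
  fixes S :: "'n::finite set"
  shows "minibatch_vector \<tau> S $ i = (if i \<in> S then real CARD('n) / real \<tau> else 0)"
proof -
  have "(\<Sum>j\<in>S. axis j (1::real) $ i) = (if i \<in> S then 1 else 0)"
    by (simp add: axis_def)
  then show ?thesis by (simp add: minibatch_vector_def)
qed

text \<open>
  Different sets give different points, since a set is the support of its vector. Hence the
  prescribed point masses add up to one, and nothing is left for the rest of the space.
\<close>

lemma minibatch_has_bochner_integral:
  fixes D :: "(real ^ 'n::finite) measure" and f :: "real ^ 'n \<Rightarrow> real"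
  assumes "prob_space D" and sets: "sets D = sets borel"
    and mb: "minibatch_sampling D \<tau>" and f: "f \<in> borel_measurable borel"
  shows "has_bochner_integral D f
    ((\<Sum>S | card S = \<tau>. f (minibatch_vector \<tau> S)) / real (CARD('n) choose \<tau>))"
proof -
  interpret prob_space D by fact
  let ?T = "{S :: 'n set. card S = \<tau>}" and ?p = "minibatch_vector \<tau> :: 'n set \<Rightarrow> real ^ 'n"
  let ?C = "real (CARD('n) choose \<tau>)"
  have tau: "1 \<le> \<tau>" "\<tau> \<le> CARD('n)"
    using mb by (auto simp: minibatch_sampling_def)
  have C: "?C > 0" using tau by simp
  have single [measurable]: "{x} \<in> sets D" for x by (simp add: sets)
  have mass: "measure D {?p S} = 1 / ?C" if "S \<in> ?T" for S
    using mb that by (auto simp: minibatch_sampling_def minibatch_vector_def)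
  have mem: "i \<in> S \<longleftrightarrow> ?p S $ i \<noteq> 0" for i S
    using tau by (simp add: minibatch_vector_nth)
  have inj: "inj ?p"
  proof
    fix S S' assume "?p S = ?p S'"
    then show "S = S'" using mem by (metis subsetI subset_antisym)
  qed
  have cardT: "card ?T = CARD('n) choose \<tau>"
    using n_subsets[of "UNIV :: 'n set" \<tau>] by simp
  have fin: "finite (?p ` ?T)" by simp
  have "measure D (?p ` ?T) = (\<Sum>x\<in>?p ` ?T. measure D {x})"
    using fin by (intro finite_measure_eq_sum_singleton) auto
  also have "\<dots> = (\<Sum>S\<in>?T. measure D {?p S})"
    using inj by (subst sum.reindex) (auto intro: inj_on_subset)
  also have "\<dots> = 1"
    using C cardT by (simp add: mass)
  finally have "AE v in D. v \<in> ?p ` ?T"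
    using fin by (intro AE_prob_1) auto
  then have ae: "AE v in D. f v = (\<Sum>S\<in>?T. f (?p S) * indicator {?p S} v)"
  proof (rule AE_mp, intro AE_I2 impI)
    fix v assume "v \<in> ?p ` ?T"
    then obtain S where S: "S \<in> ?T" "v = ?p S" by auto
    have "(\<Sum>S'\<in>?T. f (?p S') * indicator {?p S'} v) = (\<Sum>S'\<in>?T. if S' = S then f v else 0)"
      using inj S by (intro sum.cong) (auto simp: indicator_def dest: injD)
    then show "f v = (\<Sum>S\<in>?T. f (?p S) * indicator {?p S} v)" using S by simp
  qed
  have "has_bochner_integral D (\<lambda>v. \<Sum>S\<in>?T. f (?p S) * indicator {?p S} v)
      (\<Sum>S\<in>?T. f (?p S) * measure D {?p S})"
    by (intro has_bochner_integral_sum has_bochner_integral_mult_right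
        has_bochner_integral_real_indicator) (auto simp: emeasure_eq_measure)
  moreover have "(\<Sum>S\<in>?T. f (?p S) * measure D {?p S}) = (\<Sum>S\<in>?T. f (?p S)) / ?C"
    by (simp add: mass sum_divide_distrib)
  moreover have "f \<in> borel_measurable D"
    using f by (simp add: measurable_cong_sets[OF sets refl])
  ultimately show ?thesis
    using has_bochner_integral_cong_AE[OF _ _ ae, of "(\<Sum>S\<in>?T. f (?p S)) / ?C"] by simp
qed

section \<open>Estimators\<close>

lemma continuous_on_estimator [continuous_intros]:
  "continuous_on A (\<lambda>v. estimator Fs v x)"
  unfolding estimator_def by (intro continuous_intros)

lemma borel_measurable_residual_sq: "residual_sq Fs xs x \<in> borel_measurable borel"
  unfolding residual_sq_def [abs_def]
  by (intro borel_measurable_continuous_onI continuous_intros)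

lemma estimator_minibatch_vector:
  fixes Fs :: "'n::finite \<Rightarrow> real ^ 'd \<Rightarrow> real ^ 'd"
  shows "estimator Fs (minibatch_vector \<tau> S) x = (1 / real \<tau>) *\<^sub>R (\<Sum>i\<in>S. Fs i x)"
proof -
  have "(\<Sum>i\<in>UNIV. minibatch_vector \<tau> S $ i *\<^sub>R Fs i x) =
      (\<Sum>i\<in>S. (real CARD('n) / real \<tau>) *\<^sub>R Fs i x)"
    by (intro sum.mono_neutral_cong_right) (auto simp: minibatch_vector_nth)
  then show ?thesis
    by (simp add: estimator_def scaleR_sum_right)
qed

lemma residual_sq_eq:
  fixes Fs :: "'n::finite \<Rightarrow> real ^ 'd \<Rightarrow> real ^ 'd"
  shows "residual_sq Fs xs x v =
    (norm ((1 / real CARD('n)) *\<^sub>R (\<Sum>i\<in>UNIV. (v $ i - 1) *\<^sub>R (Fs i x - Fs i xs))))\<^sup>2"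
proof -
  have "(\<Sum>i\<in>UNIV. (v $ i - 1) *\<^sub>R (Fs i x - Fs i xs)) =
      ((\<Sum>i\<in>UNIV. v $ i *\<^sub>R Fs i x) - (\<Sum>i\<in>UNIV. v $ i *\<^sub>R Fs i xs)) -
      ((\<Sum>i\<in>UNIV. Fs i x) - (\<Sum>i\<in>UNIV. Fs i xs))"
    by (simp add: sum_subtractf sum.distrib algebra_simps)
  then show ?thesis
    by (simp only: residual_sq_def estimator_def mean_operator_def scaleR_right_diff_distrib)
qed

text \<open>
  A sample mean minus a constant is the sample mean of the shifted vectors. Shifted by the increment
  of the mean operator, the increments of all the operators add up to zero.
\<close>

lemma residual_sq_minibatch_vector:
  fixes Fs :: "'n::finite \<Rightarrow> real ^ 'd \<Rightarrow> real ^ 'd"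
  assumes "card S = \<tau>" "1 \<le> \<tau>"
  shows "residual_sq Fs xs x (minibatch_vector \<tau> S) =
    (norm ((1 / real \<tau>) *\<^sub>R
      (\<Sum>i\<in>S. (Fs i x - Fs i xs) - (mean_operator Fs x - mean_operator Fs xs))))\<^sup>2"
  using assms
  by (simp add: residual_sq_def estimator_minibatch_vector sum_subtractf scaleR_diff_right
      sum_constant_scaleR del: sum_constant)

lemma lipschitz_increment_norm_sq_le:
  fixes f :: "'a::real_normed_vector \<Rightarrow> 'b::real_normed_vector"
  assumes "L-lipschitz_on UNIV f"
  shows "(norm (f x - f y))\<^sup>2 \<le> L\<^sup>2 * (norm (x - y))\<^sup>2"
proof -
  have "norm (f x - f y) \<le> L * norm (x - y)"
    using lipschitz_onD[OF assms, of x y] by (simp add: dist_norm)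
  from power_mono[OF this, of 2] show ?thesis by (simp add: power_mult_distrib)
qed

section \<open>The expected residual condition\<close>

text \<open>
  The condition demands a strictly positive parameter, whereas the natural bound is zero for instance
  for full batches or for constant operators.
\<close>

lemma residual_bound_imp_expected_residual:
  assumes b: "residual_bound D Fs xs \<delta>" and "0 \<le> \<delta>"
  shows "expected_residual D Fs xs (\<delta> + 1)"
proof -
  have "(\<delta> / 2) * (norm (x - xs))\<^sup>2 \<le> (\<delta> + 1) / 2 * (norm (x - xs))\<^sup>2" for x
    by (intro mult_right_mono) auto
  then show ?thesis
    using assms unfolding expected_residual_def residual_bound_def
    by (auto intro: order_trans)
qed

text \<open>
  A pointwise bound in which \<open>x\<close> only enters through the distance to \<open>xs\<close>, so that taking
  expectations yields a single parameter for all \<open>x\<close>.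
\<close>

lemma residual_sq_le_weighted:
  fixes Fs :: "'n::finite \<Rightarrow> real ^ 'd::finite \<Rightarrow> real ^ 'd"
  assumes lip: "\<And>i. (L i)-lipschitz_on UNIV (Fs i)"
  shows "residual_sq Fs xs x v \<le>
    (1 / real CARD('n)) * (\<Sum>i\<in>UNIV. (v $ i - 1)\<^sup>2 * (L i)\<^sup>2) * (norm (x - xs))\<^sup>2"
proof -
  let ?n = "real CARD('n)"
  let ?u = "\<lambda>i. (v $ i - 1) *\<^sub>R (Fs i x - Fs i xs)"
  have "(norm (\<Sum>i\<in>UNIV. ?u i))\<^sup>2 \<le> (\<Sum>i\<in>UNIV. norm (?u i) * 1)\<^sup>2"
    using norm_sum[of ?u UNIV] by (intro power_mono) simp_all
  also have "\<dots> \<le> (\<Sum>i\<in>UNIV. (norm (?u i))\<^sup>2) * (\<Sum>i\<in>(UNIV::'n set). 1\<^sup>2)"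
    by (rule Cauchy_Schwarz_ineq_sum)
  also have "\<dots> = ?n * (\<Sum>i\<in>UNIV. (norm (?u i))\<^sup>2)" by simp
  also have "\<dots> \<le> ?n * (\<Sum>i\<in>UNIV. (v $ i - 1)\<^sup>2 * ((L i)\<^sup>2 * (norm (x - xs))\<^sup>2))"
    using lipschitz_increment_norm_sq_le[OF lip]
    by (intro mult_left_mono sum_mono) (auto simp: power_mult_distrib intro!: mult_left_mono)
  finally have "(1 / ?n)\<^sup>2 * (norm (\<Sum>i\<in>UNIV. ?u i))\<^sup>2 \<le>
      (1 / ?n)\<^sup>2 * (?n * (\<Sum>i\<in>UNIV. (v $ i - 1)\<^sup>2 * ((L i)\<^sup>2 * (norm (x - xs))\<^sup>2)))"
    by (rule mult_left_mono) simp
  then show ?thesis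
    by (simp add: residual_sq_eq power_mult_distrib power2_eq_square[of ?n] power_divide
        sum_distrib_right sum_distrib_left mult.assoc)
qed

lemma expected_residual_of_square_integrable:
  fixes D :: "(real ^ 'n::finite) measure"
    and Fs :: "'n \<Rightarrow> real ^ 'd::finite \<Rightarrow> real ^ 'd"
  assumes lip: "\<And>i. (L i)-lipschitz_on UNIV (Fs i)"
    and D: "sampling_vector D"
    and sq: "\<And>i. integrable D (\<lambda>v. (v $ i)\<^sup>2)"
  shows "\<exists>\<delta>. expected_residual D Fs xs \<delta>"
proof -
  have "prob_space D" and sets: "sets D = sets borel" and int: "\<And>i. integrable D (\<lambda>v. v $ i)"
    using D by (auto simp: sampling_vector_def)
  then interpret prob_space D by simp
  have var: "integrable D (\<lambda>v. (v $ i - 1)\<^sup>2)" for i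
    using sq[of i] int[of i] by (simp add: power2_diff)
  define h where "h v = (1 / real CARD('n)) * (\<Sum>i\<in>UNIV. (v $ i - 1)\<^sup>2 * (L i)\<^sup>2)" for v :: "real ^ 'n"
  have h: "integrable D h"
    unfolding h_def [abs_def] using var by (intro integrable_mult_right integrable_sum) auto
  have h_nonneg: "0 \<le> h v" for v by (simp add: h_def sum_nonneg)
  have le: "residual_sq Fs xs x v \<le> h v * (norm (x - xs))\<^sup>2" for x v
    unfolding h_def by (rule residual_sq_le_weighted[OF lip])
  have int_res: "integrable D (residual_sq Fs xs x)" for x
  proof (rule Bochner_Integration.integrable_bound)
    show "integrable D (\<lambda>v. h v * (norm (x - xs))\<^sup>2)" using h by simp
    show "residual_sq Fs xs x \<in> borel_measurable D"
      using borel_measurable_residual_sq by (simp add: measurable_cong_sets[OF sets refl])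
    show "AE v in D. norm (residual_sq Fs xs x v) \<le> norm (h v * (norm (x - xs))\<^sup>2)"
      using le h_nonneg by (auto simp: residual_sq_def)
  qed
  have "(LINT v|D. residual_sq Fs xs x v) \<le> (2 * (LINT v|D. h v)) / 2 * (norm (x - xs))\<^sup>2" for x
    using integral_mono[OF int_res integrable_mult_left[OF h] le] by simp
  then have "residual_bound D Fs xs (2 * (LINT v|D. h v))"
    using int_res by (auto simp: residual_bound_def)
  then show ?thesis
    using residual_bound_imp_expected_residual h_nonneg by fastforce
qed

section \<open>Minibatch sampling\<close>

lemma minibatch_delta_nonneg:
  fixes L :: "'n::finite \<Rightarrow> real"
  assumes "\<tau> \<le> CARD('n)"
  shows "0 \<le> minibatch_delta L \<tau>"
proof -
  have "1 \<le> CARD('n)" using zero_less_card_finite[where 'a='n] by linarith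
  then show ?thesis
    using assms unfolding minibatch_delta_def
    by (intro mult_nonneg_nonneg divide_nonneg_nonneg sum_nonneg) auto
qed

lemma minibatch_residual_bound:
  fixes D :: "(real ^ 'n::finite) measure"
    and Fs :: "'n \<Rightarrow> real ^ 'd::finite \<Rightarrow> real ^ 'd"
  assumes lip: "\<And>i. (L i)-lipschitz_on UNIV (Fs i)"
    and D: "prob_space D" "sets D = sets borel" and mb: "minibatch_sampling D \<tau>"
  shows "residual_bound D Fs xs (minibatch_delta L \<tau>)"
  unfolding residual_bound_def
proof
  fix x
  let ?n = "real CARD('n)"
  define w where "w i = Fs i x - Fs i xs" for i
  define m where "m = mean_operator Fs x - mean_operator Fs xs"
  define c where "c = 1 / (?n * real \<tau>) * ((?n - real \<tau>) / (?n - 1))"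
  have tau: "1 \<le> \<tau>" "\<tau> \<le> CARD('n)"
    using mb by (auto simp: minibatch_sampling_def)
  have c: "0 \<le> c"
    unfolding c_def using tau by (intro mult_nonneg_nonneg divide_nonneg_nonneg) auto
  have m: "m = (1 / ?n) *\<^sub>R (\<Sum>i\<in>UNIV. w i)"
    by (simp add: m_def w_def mean_operator_def sum_subtractf scaleR_diff_right)
  then have zero: "(\<Sum>i\<in>UNIV. w i - m) = 0"
    by (simp add: sum_subtractf sum_constant_scaleR del: sum_constant)
  have "has_bochner_integral D (residual_sq Fs xs x)
      ((\<Sum>S | card S = \<tau>. (norm ((1 / real \<tau>) *\<^sub>R (\<Sum>i\<in>S. w i - m)))\<^sup>2) / real (CARD('n) choose \<tau>))"
    using minibatch_has_bochner_integral[OF D mb borel_measurable_residual_sq, of Fs xs x] tau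
    by (simp add: residual_sq_minibatch_vector w_def m_def)
  then have hbi: "has_bochner_integral D (residual_sq Fs xs x) (c * (\<Sum>i\<in>UNIV. (norm (w i - m))\<^sup>2))"
    using subset_average_norm_sq_centred[OF tau zero] by (simp only: c_def)
  have "(\<Sum>i\<in>UNIV. (norm (w i - m))\<^sup>2) \<le> (\<Sum>i\<in>UNIV. (norm (w i))\<^sup>2)"
    unfolding m by (rule sum_norm_sq_centred_le)
  also have "\<dots> \<le> (\<Sum>i\<in>UNIV. (L i)\<^sup>2 * (norm (x - xs))\<^sup>2)"
    unfolding w_def by (intro sum_mono lipschitz_increment_norm_sq_le lip)
  finally have "c * (\<Sum>i\<in>UNIV. (norm (w i - m))\<^sup>2) \<le> c * (\<Sum>i\<in>UNIV. (L i)\<^sup>2 * (norm (x - xs))\<^sup>2)"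
    using c by (rule mult_left_mono)
  also have "\<dots> = minibatch_delta L \<tau> / 2 * (norm (x - xs))\<^sup>2"
    by (simp add: minibatch_delta_def c_def sum_distrib_right[symmetric] mult.assoc
        del: right_diff_distrib_numeral left_diff_distrib_numeral)
  finally show "integrable D (residual_sq Fs xs x) \<and>
      (LINT v|D. residual_sq Fs xs x v) \<le> minibatch_delta L \<tau> / 2 * (norm (x - xs))\<^sup>2"
    using hbi by (simp add: has_bochner_integral_iff)
qed

lemma minibatch_sigma_star:
  fixes D :: "(real ^ 'n::finite) measure"
    and Fs :: "'n \<Rightarrow> real ^ 'd::finite \<Rightarrow> real ^ 'd"
  assumes root: "mean_operator Fs xs = 0"
    and D: "prob_space D" "sets D = sets borel" and mb: "minibatch_sampling D \<tau>"
  shows "has_bochner_integral D (\<lambda>v. (norm (estimator Fs v xs))\<^sup>2)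
    (1 / (real CARD('n) * real \<tau>) * ((real CARD('n) - real \<tau>) / (real CARD('n) - 1)) *
     (\<Sum>i\<in>UNIV. (norm (Fs i xs))\<^sup>2))"
proof -
  have tau: "1 \<le> \<tau>" "\<tau> \<le> CARD('n)"
    using mb by (auto simp: minibatch_sampling_def)
  have zero: "(\<Sum>i\<in>UNIV. Fs i xs) = 0"
    using root by (simp add: mean_operator_def)
  have "(\<lambda>v. (norm (estimator Fs v xs))\<^sup>2) \<in> borel_measurable borel"
    by (intro borel_measurable_continuous_onI continuous_intros)
  from minibatch_has_bochner_integral[OF D mb this]
  show ?thesis
    unfolding estimator_minibatch_vector subset_average_norm_sq_centred[OF tau zero] .
qed

theorem proposition2p1:
  fixes D :: "(real ^ 'n::finite) measure"
    and Fs :: "'n \<Rightarrow> real ^ 'd::finite \<Rightarrow> real ^ 'd"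
    and L :: "'n \<Rightarrow> real"
    and xs :: "real ^ 'd"
  assumes "\<And>i. (L i)-lipschitz_on UNIV (Fs i)"
    and "mean_operator Fs xs = 0"
    and "sampling_vector D"
  shows "((\<forall>i. integrable D (\<lambda>v. (v $ i)\<^sup>2)) \<longrightarrow> (\<exists>\<delta>. expected_residual D Fs xs \<delta>)) \<and>
    (\<forall>\<tau>. minibatch_sampling D \<tau> \<longrightarrow>
       (\<exists>\<delta>. expected_residual D Fs xs \<delta>) \<and>
       residual_bound D Fs xs (minibatch_delta L \<tau>) \<and>
       (\<tau> < CARD('n) \<and> (\<exists>i. L i > 0) \<longrightarrow> expected_residual D Fs xs (minibatch_delta L \<tau>)) \<and>
       integrable D (\<lambda>v. (norm (estimator Fs v xs))\<^sup>2) \<and>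
       sigma_star_sq D Fs xs =
         1 / (real CARD('n) * real \<tau>) * ((real CARD('n) - real \<tau>) / (real CARD('n) - 1)) *
         (\<Sum>i\<in>UNIV. (norm (Fs i xs))\<^sup>2))"
proof -
  have D: "prob_space D" "sets D = sets borel"
    using assms(3) by (auto simp: sampling_vector_def)
  have "(\<exists>\<delta>. expected_residual D Fs xs \<delta>) \<and>
       residual_bound D Fs xs (minibatch_delta L \<tau>) \<and>
       (\<tau> < CARD('n) \<and> (\<exists>i. L i > 0) \<longrightarrow> expected_residual D Fs xs (minibatch_delta L \<tau>)) \<and>
       integrable D (\<lambda>v. (norm (estimator Fs v xs))\<^sup>2) \<and>
       sigma_star_sq D Fs xs =
         1 / (real CARD('n) * real \<tau>) * ((real CARD('n) - real \<tau>) / (real CARD('n) - 1)) *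
         (\<Sum>i\<in>UNIV. (norm (Fs i xs))\<^sup>2)"
    if mb: "minibatch_sampling D \<tau>" for \<tau>
  proof (intro conjI impI)
    have tau: "1 \<le> \<tau>" "\<tau> \<le> CARD('n)"
      using mb by (auto simp: minibatch_sampling_def)
    show bound: "residual_bound D Fs xs (minibatch_delta L \<tau>)"
      by (rule minibatch_residual_bound[OF assms(1) D mb])
    then show "\<exists>\<delta>. expected_residual D Fs xs \<delta>"
      using residual_bound_imp_expected_residual minibatch_delta_nonneg[OF tau(2)] by blast
    show "expected_residual D Fs xs (minibatch_delta L \<tau>)" if "\<tau> < CARD('n) \<and> (\<exists>i. L i > 0)"
    proof -
      from that obtain i where "L i > 0" by blast
      then have "0 < (\<Sum>i\<in>UNIV. (L i)\<^sup>2)"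
        by (intro sum_pos2[of _ i]) auto
      then have "0 < minibatch_delta L \<tau>"
        unfolding minibatch_delta_def using that tau
        by (intro mult_pos_pos divide_pos_pos) auto
      with bound show ?thesis by (simp add: expected_residual_def)
    qed
    from minibatch_sigma_star[OF assms(2) D mb]
    show "integrable D (\<lambda>v. (norm (estimator Fs v xs))\<^sup>2)"
      and "sigma_star_sq D Fs xs =
         1 / (real CARD('n) * real \<tau>) * ((real CARD('n) - real \<tau>) / (real CARD('n) - 1)) *
         (\<Sum>i\<in>UNIV. (norm (Fs i xs))\<^sup>2)"
      unfolding sigma_star_sq_def has_bochner_integral_iff by blast+
  qed
  then show ?thesis
    using expected_residual_of_square_integrable[of L Fs D xs, OF assms(1,3)] by blast
qed

end
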